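(* Let $n$ be a natural number (i.e. $n\ge1$) and $p\in(0,1)$. Put $\lambda^*_p:=\min(-\ln(1-p),1)$. Then $$\min_{\lambda>0}d_{\mathsf{TV}}(X_{n,p},\Pi_\lambda)\le d_{\mathsf{TV}}(X_{n,p},\Pi_{n\lambda^*_p})\le\begin{cases}n\big(p+(1-p)\ln(1-p)\big)&\text{if }p\le 1-e^{-1},\\ n(p-e^{-1})&\text{if }p\ge 1-e^{-1}.\end{cases}$$ Moreover, $n\big(p+(1-p)\ln(1-p)\big)\sim np^2/2$ as $p\downarrow0$ (that is, the ratio of the two sides tends to $1$).
   Context: $X_{n,p}$ denotes a random variable having the binomial distribution with parameters $n$ and $p$. For real $\lambda>0$, $\Pi_\lambda$ denotes a random variable having the Poisson distribution with parameter $\lambda$. The total variation distance is $d_{\mathsf{TV}}(X,Y):=\sup_{A}|\mathsf P(X\in A)-\mathsf P(Y\in A)|$, the supremum being over all Borel subsets $A$ of $\mathbb R$. *)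

theory Defs
  imports "HOL-Probability.Probability" "HOL-Library.Landau_Symbols"
begin

text \<open>
  The two random variables may live on different probability spaces.
\<close>

definition dTV :: "'a measure \<Rightarrow> ('a \<Rightarrow> real) \<Rightarrow> 'b measure \<Rightarrow> ('b \<Rightarrow> real) \<Rightarrow> real" where
  "dTV M X N Y =
     (SUP A \<in> sets (borel :: real measure).
        \<bar>measure M (X -` A \<inter> space M) - measure N (Y -` A \<inter> space N)\<bar>)"

definition binomial_rv :: "nat \<Rightarrow> real \<Rightarrow> 'a measure \<Rightarrow> ('a \<Rightarrow> real) \<Rightarrow> bool" where
  "binomial_rv n p M X \<longleftrightarrow> prob_space M \<and> X \<in> borel_measurable M \<and>
     distr M borel X = distr (binomial_pmf n p) borel real"

definition poisson_rv :: "real \<Rightarrow> 'a measure \<Rightarrow> ('a \<Rightarrow> real) \<Rightarrow> bool" where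
  "poisson_rv l M X \<longleftrightarrow> prob_space M \<and> X \<in> borel_measurable M \<and>
     distr M borel X = distr (poisson_pmf l) borel real"

definition lambda_star :: "real \<Rightarrow> real" where
  "lambda_star p = min (- ln (1 - p)) 1"

end

theory Submission
  imports Defs "HOL-Real_Asymp.Real_Asymp"
begin

text \<open>
  Since the binomial distribution lives on \<open>{..n}\<close>, the total variation distance to \<open>\<Pi>\<^sub>\<lambda>\<close> is one
  minus the finite sum over \<open>k \<le> n\<close> of the smaller of the two point masses, a continuous function
  of \<open>\<lambda>\<close>.  With \<open>s = \<lambda>\<^sup>* exp (-\<lambda>\<^sup>*)\<close>, where \<open>1 - p \<le> exp (-\<lambda>\<^sup>*)\<close> and \<open>s \<le> p\<close>, both the binomial mass
  at \<open>k\<close> and the Poisson mass at \<open>k\<close> with parameter \<open>n\<lambda>\<^sup>*\<close> are at least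
  \<open>(n choose k) s\<^sup>k (1 - p)\<^sup>n\<^sup>-\<^sup>k\<close>.  Summing, the overlap is at least \<open>(1 - (p - s))\<^sup>n\<close>, and Bernoulli's
  inequality bounds the distance by \<open>n (p - s)\<close>.  As \<open>s > 0\<close>, this overlap also exceeds its value
  \<open>(1 - p)\<^sup>n\<close> at \<open>\<lambda> = 0\<close>; since the overlap vanishes as \<open>\<lambda> \<rightarrow> \<infinity>\<close>, its supremum is attained at some
  \<open>\<lambda> > 0\<close>.
\<close>

text \<open>The masses are explicit formulas, so the overlap is continuous in \<open>l\<close> on
  the whole line and can be evaluated at the endpoint \<open>l = 0\<close>.\<close>

definition binomial_poisson_overlap :: "nat \<Rightarrow> real \<Rightarrow> real \<Rightarrow> real" where
  "binomial_poisson_overlap n p l =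
     (\<Sum>k\<le>n. min (real (n choose k) * p ^ k * (1 - p) ^ (n - k)) (l ^ k / fact k * exp (- l)))"

text \<open>The terms \<open>pmf P k - min (pmf P k) (pmf Q k)\<close> are nonnegative, so extending
  their sum from \<open>B \<inter> S\<close> to \<open>S\<close> only increases it. Mass of
  \<open>Q\<close> outside \<open>S\<close> only lowers the left side.\<close>

lemma prob_pmf_diff_le:
  fixes P Q :: "'a pmf"
  assumes "finite S" and "set_pmf P \<subseteq> S"
  shows "measure_pmf.prob P B - measure_pmf.prob Q B \<le> 1 - (\<Sum>k\<in>S. min (pmf P k) (pmf Q k))"
proof -
  have "measure_pmf.prob P B = measure_pmf.prob P (B \<inter> S)"
    using assms(2) by (intro measure_pmf.finite_measure_eq_AE) (auto simp: AE_measure_pmf_iff)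
  also have "\<dots> = (\<Sum>k\<in>B \<inter> S. pmf P k)"
    using assms(1) by (simp add: measure_measure_pmf_finite)
  finally have P: "measure_pmf.prob P B = (\<Sum>k\<in>B \<inter> S. pmf P k)" .
  have "(\<Sum>k\<in>B \<inter> S. pmf Q k) = measure_pmf.prob Q (B \<inter> S)"
    using assms(1) by (simp add: measure_measure_pmf_finite)
  also have "\<dots> \<le> measure_pmf.prob Q B"
    by (intro measure_pmf.finite_measure_mono) auto
  finally have Q: "(\<Sum>k\<in>B \<inter> S. pmf Q k) \<le> measure_pmf.prob Q B" .
  have "(\<Sum>k\<in>B \<inter> S. pmf P k) - (\<Sum>k\<in>B \<inter> S. pmf Q k)
      \<le> (\<Sum>k\<in>B \<inter> S. pmf P k - min (pmf P k) (pmf Q k))"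
    unfolding sum_subtractf [symmetric] by (intro sum_mono) auto
  also have "\<dots> \<le> (\<Sum>k\<in>S. pmf P k - min (pmf P k) (pmf Q k))"
    using assms(1) by (intro sum_mono2) auto
  also have "\<dots> = 1 - (\<Sum>k\<in>S. min (pmf P k) (pmf Q k))"
    using sum_pmf_eq_1 [OF assms] by (simp add: sum_subtractf)
  finally show ?thesis using P Q by linarith
qed

lemma SUP_prob_pmf_diff:
  fixes P Q :: "nat pmf"
  assumes "finite S" and "set_pmf P \<subseteq> S"
  shows "(SUP A\<in>sets (borel :: real measure).
            \<bar>measure_pmf.prob P (real -` A) - measure_pmf.prob Q (real -` A)\<bar>)
       = 1 - (\<Sum>k\<in>S. min (pmf P k) (pmf Q k))"
proof (rule cSup_eq_maximum)
  \<comment> \<open>The supremum is attained where \<open>P\<close> dominates \<open>Q\<close>; on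
    the rest of \<open>S\<close> the minimum is \<open>pmf P k\<close>, so nothing is lost.\<close>
  define T where "T = {k \<in> S. pmf Q k \<le> pmf P k}"
  have T: "finite T" "T \<subseteq> S" using assms(1) by (auto simp: T_def)
  have "measure_pmf.prob P T - measure_pmf.prob Q T = (\<Sum>k\<in>T. pmf P k - min (pmf P k) (pmf Q k))"
    using T by (simp add: measure_measure_pmf_finite sum_subtractf [symmetric])
       (auto simp: T_def intro!: sum.cong)
  also have "\<dots> = (\<Sum>k\<in>S. pmf P k - min (pmf P k) (pmf Q k))"
    using assms(1) by (intro sum.mono_neutral_left) (auto simp: T_def)
  also have "\<dots> = 1 - (\<Sum>k\<in>S. min (pmf P k) (pmf Q k))"
    using sum_pmf_eq_1 [OF assms] by (simp add: sum_subtractf)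
  finally have eq: "measure_pmf.prob P T - measure_pmf.prob Q T
    = 1 - (\<Sum>k\<in>S. min (pmf P k) (pmf Q k))" .
  \<comment> \<open>The difference at \<open>T\<close> is nonnegative, so it equals its absolute
    value.\<close>
  have "(\<Sum>k\<in>S. min (pmf P k) (pmf Q k)) \<le> (\<Sum>k\<in>S. pmf P k)" by (intro sum_mono) auto
  then have "(\<Sum>k\<in>S. min (pmf P k) (pmf Q k)) \<le> 1" using sum_pmf_eq_1 [OF assms] by simp
  then have "1 - (\<Sum>k\<in>S. min (pmf P k) (pmf Q k))
      = \<bar>measure_pmf.prob P (real -` (real ` T)) - measure_pmf.prob Q (real -` (real ` T))\<bar>"
    using eq by (simp add: inj_vimage_image_eq)
  moreover have "real ` T \<in> sets borel" using T by (intro borel_closed finite_imp_closed) auto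
  ultimately show "1 - (\<Sum>k\<in>S. min (pmf P k) (pmf Q k)) \<in>
     (\<lambda>A. \<bar>measure_pmf.prob P (real -` A) - measure_pmf.prob Q (real -` A)\<bar>) ` sets borel"
    by blast
next
  fix x assume "x \<in> (\<lambda>A. \<bar>measure_pmf.prob P (real -` A) - measure_pmf.prob Q (real -` A)\<bar>) ` sets borel"
  then obtain B where x: "x = \<bar>measure_pmf.prob P B - measure_pmf.prob Q B\<bar>" by blast
  \<comment> \<open>Complementation flips the sign of the difference, so the one-sided bound at
    \<open>B\<close> and \<open>- B\<close> controls the absolute value.\<close>
  have "measure_pmf.prob R (- B) = 1 - measure_pmf.prob R B" for R :: "nat pmf"
    using measure_pmf.prob_compl [of B R] by (simp add: Compl_eq_Diff_UNIV)
  then show "x \<le> 1 - (\<Sum>k\<in>S. min (pmf P k) (pmf Q k))"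
    using prob_pmf_diff_le [OF assms, of B Q] prob_pmf_diff_le [OF assms, of "- B" Q] x by auto
qed

text \<open>The distance depends only on the two laws, so the underlying spaces can be replaced by
  the pmfs.\<close>

lemma dTV_distr_pmf:
  assumes "X \<in> borel_measurable M" and "distr M borel X = distr (measure_pmf P) borel f"
    and "Y \<in> borel_measurable N" and "distr N borel Y = distr (measure_pmf Q) borel g"
  shows "dTV M X N Y =
     (SUP A\<in>sets borel. \<bar>measure_pmf.prob P (f -` A) - measure_pmf.prob Q (g -` A)\<bar>)"
proof -
  have "measure M (X -` A \<inter> space M) = measure_pmf.prob P (f -` A)" if "A \<in> sets borel" for A
    using that measure_distr [OF assms(1) that] assms(2) measure_distr [of f P borel A] by simp
  moreover have "measure N (Y -` A \<inter> space N) = measure_pmf.prob Q (g -` A)"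
    if "A \<in> sets borel" for A
    using that measure_distr [OF assms(3) that] assms(4) measure_distr [of g Q borel A] by simp
  ultimately show ?thesis unfolding dTV_def by (intro SUP_cong) auto
qed

lemma dTV_binomial_poisson:
  assumes "0 < p" "p < 1" "0 < l" "binomial_rv n p M X" "poisson_rv l N Y"
  shows "dTV M X N Y = 1 - binomial_poisson_overlap n p l"
proof -
  have "set_pmf (binomial_pmf n p) \<subseteq> {..n}" using assms by (simp add: set_pmf_binomial)
  from SUP_prob_pmf_diff [OF _ this, of "poisson_pmf l"] show ?thesis
    using assms
    by (subst dTV_distr_pmf [where P = "binomial_pmf n p" and Q = "poisson_pmf l"])
       (auto simp: binomial_rv_def poisson_rv_def binomial_poisson_overlap_def)
qed

lemma continuous_on_binomial_poisson_overlap: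
  "continuous_on A (binomial_poisson_overlap n p)"
  unfolding binomial_poisson_overlap_def by (intro continuous_intros) auto

lemma binomial_poisson_overlap_0:
  assumes "0 \<le> p" "p \<le> 1"
  shows "binomial_poisson_overlap n p 0 = (1 - p) ^ n"
proof -
  \<comment> \<open>At \<open>l = 0\<close> the Poisson mass is 1 at \<open>k = 0\<close> and 0
    elsewhere.\<close>
  have "binomial_poisson_overlap n p 0 = (\<Sum>k\<le>n. if k = 0 then (1 - p) ^ n else 0)"
    unfolding binomial_poisson_overlap_def using assms
    by (intro sum.cong) (auto simp: power_0_left power_le_one)
  then show ?thesis by simp
qed

text \<open>Each minimum is at most its Poisson mass, which tends to 0 for fixed \<open>k\<close>,
  and the sum is finite.\<close>

lemma binomial_poisson_overlap_tendsto_0: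
  assumes "0 \<le> p" "p \<le> 1"
  shows "(binomial_poisson_overlap n p \<longlongrightarrow> 0) at_top"
proof (rule tendsto_sandwich)
  show "\<forall>\<^sub>F l in at_top. 0 \<le> binomial_poisson_overlap n p l"
    using eventually_ge_at_top [of 0]
    by eventually_elim (use assms in \<open>auto simp: binomial_poisson_overlap_def intro!: sum_nonneg\<close>)
  show "\<forall>\<^sub>F l in at_top. binomial_poisson_overlap n p l \<le> (\<Sum>k\<le>n. l ^ k / exp l / fact k)"
    unfolding binomial_poisson_overlap_def
    by (intro always_eventually allI sum_mono) (auto simp: exp_minus field_simps)
  show "((\<lambda>l. \<Sum>k\<le>n. l ^ k / exp l / fact k :: real) \<longlongrightarrow> 0) at_top"
    by (intro tendsto_null_sum tendsto_divide_zero tendsto_power_div_exp_0)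
qed auto

lemma binomial_poisson_overlap_ge:
  assumes "p \<le> 1" "0 \<le> l" "1 - p \<le> exp (- l)" "l * exp (- l) \<le> p"
  shows "(1 - (p - l * exp (- l))) ^ n \<le> binomial_poisson_overlap n p (real n * l)"
proof -
  define s where "s = l * exp (- l)"
  have s: "0 \<le> s" "s \<le> p" using assms by (auto simp: s_def)
  have "(1 - (p - s)) ^ n = (s + (1 - p)) ^ n" by (simp add: algebra_simps)
  also have "\<dots> = (\<Sum>k\<le>n. real (n choose k) * s ^ k * (1 - p) ^ (n - k))"
    by (rule binomial_ring)
  also have "\<dots> \<le> binomial_poisson_overlap n p (real n * l)"
    unfolding binomial_poisson_overlap_def
  proof (intro sum_mono min.boundedI)
    fix k assume "k \<in> {..n}"
    then have k: "k \<le> n" by simp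
    show "real (n choose k) * s ^ k * (1 - p) ^ (n - k)
        \<le> real (n choose k) * p ^ k * (1 - p) ^ (n - k)"
      using s assms by (intro mult_right_mono mult_left_mono power_mono) auto
    have "fact k * (n choose k) \<le> n ^ k"
      using binomial_fact_pow [of n k] by (simp add: mult.commute)
    then have "real (fact k * (n choose k)) \<le> real (n ^ k)" by (rule of_nat_mono)
    then have choose: "real (n choose k) \<le> real n ^ k / fact k"
      by (simp add: field_simps)
    \<comment> \<open>Of the \<open>n\<close> factors \<open>exp (- l)\<close>, \<open>k\<close> are
      absorbed into \<open>s ^ k\<close>; the other \<open>n - k\<close> dominate
      \<open>1 - p\<close>.\<close>
    have "exp (- l) ^ k * exp (- l) ^ (n - k) = exp (- l) ^ n"
      using k by (simp flip: power_add)
    also have "\<dots> = exp (- (real n * l))"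
      using exp_of_nat_mult [of n "- l"] by simp
    finally have "exp (- l) ^ k * exp (- l) ^ (n - k) = exp (- (real n * l))" .
    then have "(real n * l) ^ k / fact k * exp (- (real n * l))
        = real n ^ k / fact k * s ^ k * exp (- l) ^ (n - k)"
      by (simp add: s_def power_mult_distrib)
    also have "\<dots> \<ge> real (n choose k) * s ^ k * (1 - p) ^ (n - k)"
      using s assms choose by (intro mult_mono power_mono) auto
    finally show "real (n choose k) * s ^ k * (1 - p) ^ (n - k)
        \<le> (real n * l) ^ k / fact k * exp (- (real n * l))" .
  qed
  finally show ?thesis by (simp add: s_def)
qed

text \<open>Beyond some \<open>L\<close> the values stay below \<open>f a\<close>, so a maximum over
  the compact interval up to \<open>max a L\<close> is global; it is not at 0, where
  \<open>f\<close> is also below \<open>f a\<close>.\<close>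

lemma attains_max_on_positive_reals:
  fixes f :: "real \<Rightarrow> real"
  assumes cont: "continuous_on {0..} f" and lim: "(f \<longlongrightarrow> c) at_top"
    and a: "0 < a" "f 0 < f a" "c < f a"
  obtains x where "0 < x" "\<And>y. 0 < y \<Longrightarrow> f y \<le> f x"
proof -
  from order_tendstoD(2) [OF lim a(3)] obtain L where L: "\<And>y. y \<ge> L \<Longrightarrow> f y < f a"
    by (auto simp: eventually_at_top_linorder)
  have "\<exists>x\<in>{0..max a L}. \<forall>y\<in>{0..max a L}. f y \<le> f x"
    using a by (intro continuous_attains_sup continuous_on_subset [OF cont]) auto
  then obtain x where x: "x \<in> {0..max a L}" "\<And>y. y \<in> {0..max a L} \<Longrightarrow> f y \<le> f x" by blast
  have "f a \<le> f x" using x(2) [of a] a by auto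
  then have "x \<noteq> 0" using a by auto
  then have "0 < x" using x by auto
  moreover have "f y \<le> f x" if "0 < y" for y
    using that x(2) [of y] L [of y] \<open>f a \<le> f x\<close> by (cases "y \<le> max a L") force+
  ultimately show thesis using that by blast
qed

lemma lambda_star_bounds:
  assumes "0 < p" "p < 1"
  shows "0 < lambda_star p" "1 - p \<le> exp (- lambda_star p)"
    "lambda_star p * exp (- lambda_star p) \<le> p"
proof -
  show pos: "0 < lambda_star p" using assms by (auto simp: lambda_star_def)
  have "exp (ln (1 - p)) \<le> exp (- lambda_star p)"
    unfolding exp_le_cancel_iff lambda_star_def by auto
  then show "1 - p \<le> exp (- lambda_star p)" using assms by simp
  \<comment> \<open>This is \<open>1 + x \<le> exp x\<close> multiplied by \<open>exp (- x)\<close>.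
    It settles the case \<open>exp (- lambda_star p) = 1 - p\<close>.\<close>
  have tangent: "x * exp (- x) \<le> 1 - exp (- x)" for x :: real
    using exp_ge_add_one_self [of x] by (simp add: exp_minus field_simps)
  show "lambda_star p * exp (- lambda_star p) \<le> p"
  proof -
    have "exp (- lambda_star p) = 1 - p \<or> lambda_star p = 1"
      using assms by (auto simp: lambda_star_def min_def)
    moreover have "exp (-1 :: real) \<le> p" if "lambda_star p = 1"
    proof -
      have "ln (1 - p) \<le> -1" using that by (simp add: lambda_star_def min_def split: if_splits)
      then have "1 - p \<le> exp (-1)" 
        using assms by (metis diff_gt_0_iff_gt exp_le_cancel_iff exp_ln)
      \<comment> \<open>Hence \<open>p \<ge> 1 - exp (-1) \<ge> 1/2 \<ge> exp (-1)\<close>.\<close>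
      moreover have "exp (-1) \<le> (1/2 :: real)"
        using exp_ge_add_one_self [of 1] by (simp add: exp_minus field_simps)
      ultimately show ?thesis by linarith
    qed
    ultimately show ?thesis using tangent [of "lambda_star p"] by auto
  qed
qed

theorem corollary2:
  fixes n :: nat and p :: real
    and M :: "'a measure" and X :: "'a \<Rightarrow> real"
    and N :: "real \<Rightarrow> 'b measure" and Y :: "real \<Rightarrow> 'b \<Rightarrow> real"
  assumes "n \<ge> 1" and "0 < p" and "p < 1"
    and "binomial_rv n p M X"
    and "\<And>l. l > 0 \<Longrightarrow> poisson_rv l (N l) (Y l)"
  shows "(\<exists>l0. is_arg_min (\<lambda>l. dTV M X (N l) (Y l)) (\<lambda>l. l > 0) l0 \<and>
            dTV M X (N l0) (Y l0)
              \<le> dTV M X (N (real n * lambda_star p)) (Y (real n * lambda_star p)))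
       \<and> (p \<le> 1 - exp (-1) \<longrightarrow>
            dTV M X (N (real n * lambda_star p)) (Y (real n * lambda_star p))
              \<le> real n * (p + (1 - p) * ln (1 - p)))
       \<and> (p \<ge> 1 - exp (-1) \<longrightarrow>
            dTV M X (N (real n * lambda_star p)) (Y (real n * lambda_star p))
              \<le> real n * (p - exp (-1)))
       \<and> (\<lambda>q::real. real n * (q + (1 - q) * ln (1 - q)))
            \<sim>[at_right 0] (\<lambda>q. real n * q\<^sup>2 / 2)"
proof -
  define d where "d = (\<lambda>l. dTV M X (N l) (Y l))"
  define h where "h = binomial_poisson_overlap n p"
  define l where "l = lambda_star p"
  define s where "s = l * exp (- l)"
  have d: "d x = 1 - h x" if "x > 0" for x
    using dTV_binomial_poisson [OF assms(2,3) that assms(4) assms(5) [OF that]]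
    by (simp add: d_def h_def)
  have l: "0 < l" "1 - p \<le> exp (- l)" "s \<le> p"
    using lambda_star_bounds [OF assms(2,3)] by (auto simp: l_def s_def)
  then have nl: "0 < real n * l" using assms(1) by simp
  have s: "0 < s" using l by (simp add: s_def)
  have ge: "(1 - (p - s)) ^ n \<le> h (real n * l)"
    using binomial_poisson_overlap_ge [of p l n] l assms(3) by (simp add: h_def s_def)
  have "1 + real n * - (p - s) \<le> (1 + - (p - s)) ^ n"
    by (rule Bernoulli_inequality) (use assms s in linarith)
  with ge d [OF nl] have bound: "d (real n * l) \<le> real n * (p - s)"
    by (simp add: algebra_simps)

  \<comment> \<open>Strictness, from \<open>s > 0\<close> and \<open>n \<ge> 1\<close>, keeps the
    maximiser of the overlap away from 0.\<close>
  have "(1 - p) ^ n < (1 - (p - s)) ^ n"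
    by (rule power_strict_mono) (use assms s in auto)
  with ge have gt: "(1 - p) ^ n < h (real n * l)" by simp
  have "0 < h (real n * l)" by (rule le_less_trans [OF _ gt]) (use assms in simp)
  obtain l0 where l0: "0 < l0" "\<And>y. 0 < y \<Longrightarrow> h y \<le> h l0"
  proof (rule attains_max_on_positive_reals)
    show "continuous_on {0..} h"
      unfolding h_def by (rule continuous_on_binomial_poisson_overlap)
    show "(h \<longlongrightarrow> 0) at_top"
      unfolding h_def using assms by (intro binomial_poisson_overlap_tendsto_0) auto
    show "h 0 < h (real n * l)"
      using gt assms by (simp add: h_def binomial_poisson_overlap_0)
  qed (use nl \<open>0 < h (real n * l)\<close> in auto)
  \<comment> \<open>On positive parameters \<open>d = 1 - h\<close>, so maximising \<open>h\<close>
    minimises \<open>d\<close>.\<close>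
  have "\<not> d y < d l0" if "0 < y" for y
    using l0 that by (simp add: d not_less)
  then have "is_arg_min d (\<lambda>l. l > 0) l0 \<and> d l0 \<le> d (real n * l)"
    using l0 nl by (auto simp: is_arg_min_def d)
  moreover have "s = - ((1 - p) * ln (1 - p))" if "p \<le> 1 - exp (-1)"
  proof -
    have "ln (exp (-1)) \<le> ln (1 - p)" using that assms by (subst ln_le_cancel_iff) auto
    then have "l = - ln (1 - p)" by (simp add: l_def lambda_star_def)
    then show ?thesis using assms by (simp add: s_def)
  qed
  moreover have "s = exp (-1)" if "p \<ge> 1 - exp (-1)"
  proof -
    have "ln (1 - p) \<le> ln (exp (-1))" using that assms by (subst ln_le_cancel_iff) auto
    then have "l = 1" by (simp add: l_def lambda_star_def)
    then show ?thesis by (simp add: s_def)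
  qed
  \<comment> \<open>From \<open>ln (1 - q) = - q - q^2/2 + O(q^3)\<close>, the bracket is
    \<open>q^2/2 + O(q^3)\<close>.\<close>
  moreover have "(\<lambda>q::real. real n * (q + (1 - q) * ln (1 - q))) \<sim>[at_right 0] (\<lambda>q. real n * q\<^sup>2 / 2)"
    using assms(1) by real_asymp
  ultimately show ?thesis
    using bound unfolding d_def l_def by auto
qed

end
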